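(* Let $ABC$ be a triangle with $\angle ABC=60^\circ$ and let $P$ be its incenter. Let the cevians through $P$ be $AD$, $BE$, $CF$ with $D$ on $BC$, $E$ on $CA$, $F$ on $AB$, and let $r_1,\dots,r_6$ be the inradii of triangles $PBD$, $PDC$, $PCE$, $PEA$, $PAF$, $PFB$, respectively. Then $$\frac{1}{r_1}+\frac{1}{r_4}+\frac{1}{r_5}=\frac{1}{r_2}+\frac{1}{r_3}+\frac{1}{r_6}.$$
   Context: For a point $P$ inside $\triangle ABC$, line $AP$ meets side $BC$ at $D$, line $BP$ meets side $CA$ at $E$, and line $CP$ meets side $AB$ at $F$. The three cevians divide $\triangle ABC$ into six smaller triangles, numbered 1 to 6 in the order $PBD$, $PDC$, $PCE$, $PEA$, $PAF$, $PFB$; $r_i$ is the inradius of the $i$-th triangle. *)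

theory Defs
  imports "HOL-Analysis.Analysis"
begin

text \<open>The unoriented angle at \<open>Y\<close> between the rays \<open>YX\<close> and \<open>YZ\<close>, in radians, with values in
  \<open>[0, pi]\<close>; it is meaningful only for \<open>X \<noteq> Y\<close> and \<open>Z \<noteq> Y\<close>.\<close>

definition angle_at :: "real ^ 2 \<Rightarrow> real ^ 2 \<Rightarrow> real ^ 2 \<Rightarrow> real" where
  "angle_at X Y Z = arccos ((X - Y) \<bullet> (Z - Y) / (norm (X - Y) * norm (Z - Y)))"

abbreviation line :: "real ^ 2 \<Rightarrow> real ^ 2 \<Rightarrow> (real ^ 2) set" where
  "line X Y \<equiv> affine hull {X, Y}"

definition tangent_to :: "real ^ 2 \<Rightarrow> real \<Rightarrow> (real ^ 2) set \<Rightarrow> bool" where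
  "tangent_to I r L \<longleftrightarrow> (\<exists>!T. T \<in> sphere I r \<inter> L)"

text \<open>Four circles are tangent to all three side lines of a triangle; requiring the centre to lie
  inside the triangle singles out the inscribed one and excludes the three excircles.\<close>

definition is_incircle :: "real ^ 2 \<Rightarrow> real ^ 2 \<Rightarrow> real ^ 2 \<Rightarrow> real ^ 2 \<Rightarrow> real \<Rightarrow> bool" where
  "is_incircle X Y Z I r \<longleftrightarrow>
     0 < r \<and> I \<in> interior (convex hull {X, Y, Z}) \<and>
     tangent_to I r (line X Y) \<and> tangent_to I r (line Y Z) \<and> tangent_to I r (line Z X)"

definition is_incenter :: "real ^ 2 \<Rightarrow> real ^ 2 \<Rightarrow> real ^ 2 \<Rightarrow> real ^ 2 \<Rightarrow> bool" where
  "is_incenter X Y Z I \<longleftrightarrow> (\<exists>r. is_incircle X Y Z I r)"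

text \<open>A nondegenerate triangle has exactly one incircle; \<open>inradius\<close> is unspecified for collinear
  vertices.\<close>

definition inradius :: "real ^ 2 \<Rightarrow> real ^ 2 \<Rightarrow> real ^ 2 \<Rightarrow> real" where
  "inradius X Y Z = (THE r. \<exists>I. is_incircle X Y Z I r)"

end

theory Submission
  imports Defs
begin

text \<open>The inradius is twice the area over the perimeter. Writing \<open>a, b, c\<close> for the sides and
  \<open>x, y, z\<close> for \<open>PA, PB, PC\<close>, the lengths and areas of the six triangles are rational functions of
  these, and the difference of the two sides of the claim is proportional to
  \<open>a (a + b) x - c (b + c) z\<close>. Since \<open>x\<^sup>2 = b c (b + c - a) / (a + b + c)\<close> and similarly for \<open>z\<close>,
  this vanishes exactly when \<open>a (a + b)\<^sup>2 (b + c - a) = c (b + c)\<^sup>2 (a + b - c)\<close>, which follows from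
  the law of cosines \<open>b\<^sup>2 = a\<^sup>2 + c\<^sup>2 - a c\<close>.\<close>

section \<open>Signed areas: \<open>cross2 X Y Z\<close> is twice the signed area of the
  triangle\<close>

definition cross2 :: "real ^ 2 \<Rightarrow> real ^ 2 \<Rightarrow> real ^ 2 \<Rightarrow> real" where
  "cross2 X Y Z = (Y$1 - X$1) * (Z$2 - X$2) - (Y$2 - X$2) * (Z$1 - X$1)"

lemma collinear_iff_cross2: "collinear {X, Y, Z} \<longleftrightarrow> cross2 X Y Z = 0"
proof -
  define u v where "u = X - Y" and "v = Z - Y"
  have "u = 0 \<or> v = 0 \<or> (\<exists>k. v = k *\<^sub>R u) \<longleftrightarrow> u$1 * v$2 = u$2 * v$1"
  proof
    assume "u$1 * v$2 = u$2 * v$1"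
    then have "v = (v$1 / u$1) *\<^sub>R u" if "u$1 \<noteq> 0"
      using that by (simp add: vec_eq_iff forall_2 field_simps)
    moreover have "v = (v$2 / u$2) *\<^sub>R u" if "u$2 \<noteq> 0"
      using that \<open>u$1 * v$2 = u$2 * v$1\<close> by (simp add: vec_eq_iff forall_2 field_simps)
    moreover have "u = 0" if "u$1 = 0" "u$2 = 0"
      using that by (simp add: vec_eq_iff forall_2)
    ultimately show "u = 0 \<or> v = 0 \<or> (\<exists>k. v = k *\<^sub>R u)" by blast
  qed auto
  moreover have "u$1 * v$2 - u$2 * v$1 = - cross2 X Y Z"
    by (simp add: u_def v_def cross2_def algebra_simps)
  moreover have "collinear {X, Y, Z} \<longleftrightarrow> collinear {0, u, v}"
    unfolding u_def v_def by (rule collinear_3) simp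
  ultimately show ?thesis by (auto simp: collinear_lemma)
qed

lemma cross2_rotate: "cross2 Y Z X = cross2 X Y Z"
  by (simp add: cross2_def algebra_simps)

text \<open>Signed area over the base \<open>Y Z\<close> is affine in the apex and vanishes at
  \<open>Y\<close> and \<open>Z\<close>, so only the weight of \<open>X\<close> survives.
  Barycentric coordinates are thus ratios of areas.\<close>

lemma cross2_barycentric:
  assumes "u + v + w = 1"
  shows "cross2 (u *\<^sub>R X + v *\<^sub>R Y + w *\<^sub>R Z) Y Z = u * cross2 X Y Z"
proof -
  have u: "u = 1 - v - w" using assms by simp
  show ?thesis unfolding u by (simp add: cross2_def algebra_simps)
qed

section \<open>Tangency to a line and the incircle\<close>

lemma dist_power2_2D: "(dist X Y)\<^sup>2 = (X$1 - Y$1)\<^sup>2 + (X$2 - Y$2)\<^sup>2" for X Y :: "real ^ 2"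
  unfolding dist_norm power2_norm_eq_inner by (simp add: inner_vec_def sum_2 power2_eq_square)

lemma ex1_root_quadratic:
  fixes a b c :: real
  assumes "a > 0"
  shows "(\<exists>!t. a * t\<^sup>2 + 2 * b * t + c = 0) \<longleftrightarrow> b\<^sup>2 = a * c"
proof -
  have sq: "a * t\<^sup>2 + 2 * b * t + c = 0 \<longleftrightarrow> (a * t + b)\<^sup>2 = b\<^sup>2 - a * c" for t
  proof -
    have "a * (a * t\<^sup>2 + 2 * b * t + c) = (a * t + b)\<^sup>2 - (b\<^sup>2 - a * c)"
      by (simp add: power2_eq_square algebra_simps)
    with assms show ?thesis by (metis eq_iff_diff_eq_0 less_irrefl mult_eq_0_iff)
  qed
  show ?thesis
  proof
    assume ex1: "\<exists>!t. a * t\<^sup>2 + 2 * b * t + c = 0"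
    then obtain t where t: "(a * t + b)\<^sup>2 = b\<^sup>2 - a * c" unfolding sq by blast
    \<comment> \<open>The reflection of \<open>t\<close> in the axis of the parabola is again a
      root, so uniqueness forces \<open>t\<close> onto the axis, where the discriminant
      vanishes.\<close>
    define t' where "t' = - t - 2 * b / a"
    have t': "a * t' + b = - (a * t + b)" using assms by (simp add: t'_def field_simps)
    have "(a * t' + b)\<^sup>2 = b\<^sup>2 - a * c" unfolding t' power2_minus by (rule t)
    with t ex1 have "t' = t" unfolding sq by blast
    then have "a * t + b = 0" using t' by simp
    with t show "b\<^sup>2 = a * c" by simp
  next
    assume "b\<^sup>2 = a * c"
    then show "\<exists>!t. a * t\<^sup>2 + 2 * b * t + c = 0"
      unfolding sq using assms
      by (intro ex1I[of _ "- b / a"]) (auto simp: field_simps)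
  qed
qed

text \<open>Tangency means that the distance from \<open>I\<close> to the line is \<open>r\<close>,
  and base times height is twice the area. Squaring removes the orientation. Along a parametrization
  of the line, the sphere becomes a quadratic that must have a double root.\<close>

lemma tangent_to_line_iff:
  assumes "X \<noteq> Y" "0 < r"
  shows "tangent_to I r (line X Y) \<longleftrightarrow> (cross2 I X Y)\<^sup>2 = (r * dist X Y)\<^sup>2"
proof -
  define g where "g t = X + t *\<^sub>R (Y - X)" for t
  have line: "line X Y = range g" by (simp add: affine_hull_2_alt g_def)
  have inj: "inj g" using assms(1) by (auto simp: g_def inj_on_def)
  define a where "a = (dist X Y)\<^sup>2"
  define b where "b = (X - I) \<bullet> (Y - X)"
  define c where "c = (dist I X)\<^sup>2 - r\<^sup>2"
  have "a > 0" using assms by (simp add: a_def)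
  have root: "g t \<in> sphere I r \<longleftrightarrow> a * t\<^sup>2 + 2 * b * t + c = 0" for t
  proof -
    have "g t \<in> sphere I r \<longleftrightarrow> (dist I (g t))\<^sup>2 = r\<^sup>2"
      using assms(2) by (simp add: power2_eq_iff_nonneg)
    also have "(dist I (g t))\<^sup>2 - r\<^sup>2 = a * t\<^sup>2 + 2 * b * t + c"
      unfolding a_def b_def c_def dist_power2_2D g_def
      by (simp add: inner_vec_def sum_2 power2_eq_square algebra_simps)
    then have "(dist I (g t))\<^sup>2 = r\<^sup>2 \<longleftrightarrow> a * t\<^sup>2 + 2 * b * t + c = 0" by linarith
    finally show ?thesis .
  qed
  have "tangent_to I r (line X Y) \<longleftrightarrow> (\<exists>!t. g t \<in> sphere I r)"
    unfolding tangent_to_def line using inj by (auto simp: inj_eq) (metis injD rangeI)+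
  also have "\<dots> \<longleftrightarrow> b\<^sup>2 = a * c"
    unfolding root by (rule ex1_root_quadratic) fact
  also have "\<dots> \<longleftrightarrow> (cross2 I X Y)\<^sup>2 = (r * dist X Y)\<^sup>2"
  proof -
    \<comment> \<open>Lagrange's identity: the product of two squared norms is the square of the
      inner product plus the square of the cross product.\<close>
    have "a * c - b\<^sup>2 = (cross2 I X Y)\<^sup>2 - (r * dist X Y)\<^sup>2"
      unfolding a_def b_def c_def power_mult_distrib dist_power2_2D cross2_def
      by (simp add: inner_vec_def sum_2 power2_eq_square algebra_simps)
    then show ?thesis by linarith
  qed
  finally show ?thesis .
qed

text \<open>An interior point has positive barycentric coordinates, and tangency makes each of them,
  times twice the area, equal to \<open>r\<close> times the opposite side. Summing the three
  equations determines \<open>r\<close> and then \<open>I\<close>. The equivalence yields both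
  existence and uniqueness, which the \<open>THE\<close> in \<open>inradius\<close>
  requires.\<close>

lemma is_incircle_iff:
  assumes nc: "\<not> collinear {X, Y, Z}"
  defines "p \<equiv> dist Y Z + dist Z X + dist X Y"
  shows "is_incircle X Y Z I r \<longleftrightarrow>
    I = (dist Y Z / p) *\<^sub>R X + (dist Z X / p) *\<^sub>R Y + (dist X Y / p) *\<^sub>R Z \<and>
    r = \<bar>cross2 X Y Z\<bar> / p"
proof -
  define \<Delta> where "\<Delta> = \<bar>cross2 X Y Z\<bar>"
  have neq: "X \<noteq> Y" "Y \<noteq> Z" "Z \<noteq> X" and \<Delta>: "\<Delta> > 0"
    using nc by (auto simp: \<Delta>_def collinear_iff_cross2 cross2_def)
  then have pos: "dist Y Z > 0" "dist Z X > 0" "dist X Y > 0" by auto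
  then have p: "p > 0" unfolding p_def by linarith
  have tangent: "tangent_to I r (line X Y) \<and> tangent_to I r (line Y Z) \<and> tangent_to I r (line Z X) \<longleftrightarrow>
      u * \<Delta> = r * dist Y Z \<and> v * \<Delta> = r * dist Z X \<and> w * \<Delta> = r * dist X Y"
    if "0 < r" "0 < u" "0 < v" "0 < w" "u + v + w = 1" "I = u *\<^sub>R X + v *\<^sub>R Y + w *\<^sub>R Z" for u v w
  proof -
    \<comment> \<open>Both bases are nonnegative once the sign of the area is dropped, so the
      squares can be removed.\<close>
    have *: "(x * cross2 X Y Z)\<^sup>2 = (r * d)\<^sup>2 \<longleftrightarrow> x * \<Delta> = r * d" if "0 < x" "0 < d" for x d
    proof -
      have "(x * cross2 X Y Z)\<^sup>2 = (x * \<Delta>)\<^sup>2" by (simp add: \<Delta>_def power_mult_distrib)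
      then show ?thesis using that \<open>0 < r\<close> \<Delta> by simp
    qed
    have "cross2 I Y Z = u * cross2 X Y Z"
      using that by (simp add: cross2_barycentric)
    moreover have "cross2 I Z X = v * cross2 X Y Z"
      using cross2_barycentric[of v w u Y Z X] that by (simp add: cross2_rotate[of Y Z X] add_ac)
    moreover have "cross2 I X Y = w * cross2 X Y Z"
      using cross2_barycentric[of w u v Z X Y] that by (simp add: cross2_rotate[of X Y Z, symmetric] add_ac)
    ultimately show ?thesis using that neq pos by (auto simp: tangent_to_line_iff *)
  qed
  have int: "I \<in> interior (convex hull {X, Y, Z}) \<longleftrightarrow>
      (\<exists>u v w. 0 < u \<and> 0 < v \<and> 0 < w \<and> u + v + w = 1 \<and> u *\<^sub>R X + v *\<^sub>R Y + w *\<^sub>R Z = I)"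
    using nc by (subst interior_convex_hull_3_minimal) auto
  show ?thesis
  proof
    assume L: "is_incircle X Y Z I r"
    then obtain u v w where uvw: "0 < u" "0 < v" "0 < w" "u + v + w = 1"
        "I = u *\<^sub>R X + v *\<^sub>R Y + w *\<^sub>R Z" and r: "0 < r"
      unfolding is_incircle_def int by blast
    from tangent[OF r uvw] L have e: "u * \<Delta> = r * dist Y Z" "v * \<Delta> = r * dist Z X" "w * \<Delta> = r * dist X Y"
      unfolding is_incircle_def by auto
    have "(u + v + w) * \<Delta> = r * p" by (simp add: e p_def distrib_left distrib_right)
    then have rp: "\<Delta> = r * p" using uvw by simp
    have "u = dist Y Z / p" "v = dist Z X / p" "w = dist X Y / p"
      using e r p by (auto simp: rp field_simps)
    then show "I = (dist Y Z / p) *\<^sub>R X + (dist Z X / p) *\<^sub>R Y + (dist X Y / p) *\<^sub>R Z \<and>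
      r = \<bar>cross2 X Y Z\<bar> / p" using uvw rp p by (simp add: \<Delta>_def)
  next
    assume R: "I = (dist Y Z / p) *\<^sub>R X + (dist Z X / p) *\<^sub>R Y + (dist X Y / p) *\<^sub>R Z \<and>
      r = \<bar>cross2 X Y Z\<bar> / p"
    then have r: "r = \<Delta> / p" "0 < r" using \<Delta> p by (auto simp: \<Delta>_def)
    have uvw: "0 < dist Y Z / p" "0 < dist Z X / p" "0 < dist X Y / p"
      "dist Y Z / p + dist Z X / p + dist X Y / p = 1"
      using pos p by (auto simp: p_def simp flip: add_divide_distrib)
    show "is_incircle X Y Z I r"
      unfolding is_incircle_def int using tangent[OF r(2) uvw] R uvw r by auto
  qed
qed

lemma one_div_inradius:
  assumes "cross2 X Y Z \<noteq> 0"
  shows "1 / inradius X Y Z = (dist Y Z + dist Z X + dist X Y) / \<bar>cross2 X Y Z\<bar>"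
proof -
  have "\<not> collinear {X, Y, Z}" using assms by (simp add: collinear_iff_cross2)
  then have "inradius X Y Z = \<bar>cross2 X Y Z\<bar> / (dist Y Z + dist Z X + dist X Y)"
    unfolding inradius_def by (simp add: is_incircle_iff)
  then show ?thesis by simp
qed

text \<open>The formulas come from \<open>YD : DZ = c : b\<close> and \<open>XP : PD = (b + c) : a\<close>.\<close>

lemma incenter_cevian:
  fixes X Y Z P D :: "real ^ 2"
  assumes nc: "\<not> collinear {X, Y, Z}" and P: "is_incenter X Y Z P"
    and D: "D \<in> line X P" "D \<in> closed_segment Y Z"
  defines "a \<equiv> dist Y Z" and "b \<equiv> dist Z X" and "c \<equiv> dist X Y"
  shows "1 / inradius P Y D =
      (a + b + c) / \<bar>cross2 X Y Z\<bar> * (1 + dist P Y * (b + c) / (a * c) + dist P X / c)"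
    and "1 / inradius P D Z =
      (a + b + c) / \<bar>cross2 X Y Z\<bar> * (1 + dist P Z * (b + c) / (a * b) + dist P X / b)"
    and "(dist P X)\<^sup>2 * (a + b + c) = b * c * (b + c - a)"
proof -
  define p where "p = a + b + c"
  define \<Delta> where "\<Delta> = cross2 X Y Z"
  have \<Delta>: "\<Delta> \<noteq> 0" and pos: "a > 0" "b > 0" "c > 0"
    using nc by (auto simp: \<Delta>_def collinear_iff_cross2 cross2_def a_def b_def c_def)
  have p: "p > 0" using pos by (simp add: p_def)
  have P: "P = (a / p) *\<^sub>R X + (b / p) *\<^sub>R Y + (c / p) *\<^sub>R Z"
    using P unfolding is_incenter_def is_incircle_iff[OF nc] a_def b_def c_def p_def by blast
  obtain s where s: "D = Y + s *\<^sub>R (Z - Y)"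
    using D(2) by (auto simp: in_segment algebra_simps)
  obtain t where t: "D = X + t *\<^sub>R (P - X)"
    using D(1) by (auto simp: affine_hull_2_alt)
  have PX: "P - X = (b / p) *\<^sub>R (Y - X) + (c / p) *\<^sub>R (Z - X)"
  proof -
    have "a / p + b / p + c / p = 1" using p by (simp add: p_def flip: add_divide_distrib)
    then have ap: "a / p = 1 - b / p - c / p" by simp
    show ?thesis unfolding P ap by (simp add: algebra_simps)
  qed
  have s_eq: "s = c / (b + c)"
  proof -
    \<comment> \<open>Collinearity of \<open>X\<close>, \<open>P\<close>, \<open>D\<close> is a
      linear equation for the position \<open>s\<close> of \<open>D\<close> on
      \<open>Y Z\<close>.\<close>
    have "cross2 X P D = 0" unfolding t by (simp add: cross2_def)
    moreover have "cross2 X P D = (b / p * s - c / p * (1 - s)) * \<Delta>"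
    proof -
      \<comment> \<open>The coefficients \<open>b / p\<close> and \<open>c / p\<close> are
        generalized to \<beta> and \<gamma>, so that the identity is purely polynomial.\<close>
      have "cross2 X P D = (\<beta> * s - \<gamma> * (1 - s)) * \<Delta>"
        if PX: "P - X = \<beta> *\<^sub>R (Y - X) + \<gamma> *\<^sub>R (Z - X)" for \<beta> \<gamma>
      proof -
        have P: "P = X + \<beta> *\<^sub>R (Y - X) + \<gamma> *\<^sub>R (Z - X)" using PX by (simp add: algebra_simps)
        show ?thesis unfolding P s \<Delta>_def cross2_def by (simp add: algebra_simps)
      qed
      then show ?thesis using PX by blast
    qed
    ultimately have "b / p * s = c / p * (1 - s)" using \<Delta> by simp
    then show ?thesis using p pos by (simp add: field_simps)
  qed
  have bs: "b / (b + c) = 1 - s" using pos by (simp add: s_eq field_simps)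
  have YD: "dist Y D = a * c / (b + c)" and DZ: "dist D Z = a * b / (b + c)"
  proof -
    have "D - Y = (c / (b + c)) *\<^sub>R (Z - Y)" by (simp add: s s_eq)
    then have "norm (D - Y) = c / (b + c) * norm (Z - Y)" using pos by simp
    then show "dist Y D = a * c / (b + c)"
      by (simp add: a_def dist_norm norm_minus_commute)
    have "Z - D = (b / (b + c)) *\<^sub>R (Z - Y)" unfolding bs by (simp add: s algebra_simps)
    then have "norm (Z - D) = b / (b + c) * norm (Z - Y)" using pos by simp
    then show "dist D Z = a * b / (b + c)"
      by (simp add: a_def dist_norm norm_minus_commute)
  qed
  have PD: "dist D P = a / (b + c) * dist P X"
  proof -
    have D': "D = (b / (b + c)) *\<^sub>R Y + (c / (b + c)) *\<^sub>R Z"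
      unfolding bs s_eq[symmetric] by (simp add: s algebra_simps)
    have "(b + c) *\<^sub>R D = b *\<^sub>R Y + c *\<^sub>R Z"
      unfolding D' using pos by (simp add: scaleR_add_right)
    moreover have "p *\<^sub>R P = a *\<^sub>R X + b *\<^sub>R Y + c *\<^sub>R Z"
      unfolding P using p by (simp add: scaleR_add_right)
    \<comment> \<open>Masses \<open>b\<close> at \<open>Y\<close> and \<open>c\<close> at
      \<open>Z\<close> balance at \<open>D\<close>; adding mass \<open>a\<close> at \<open>X\<close>
      moves the balance point to \<open>P\<close>, which gives the ratio on the cevian.\<close>
    ultimately have "(b + c) *\<^sub>R (D - P) = a *\<^sub>R (P - X)"
      by (simp add: p_def algebra_simps)
    then have "norm ((b + c) *\<^sub>R (D - P)) = norm (a *\<^sub>R (P - X))" by (rule arg_cong)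
    then have "(b + c) * dist D P = a * dist P X" using pos unfolding norm_scaleR by (simp add: dist_norm)
    then show ?thesis using pos by (simp add: field_simps)
  qed
  have PYZ: "cross2 P Y Z = a / p * \<Delta>"
    unfolding P \<Delta>_def using p
    by (intro cross2_barycentric) (simp add: p_def flip: add_divide_distrib)
  \<comment> \<open>The triangles share the apex \<open>P\<close>, so their areas divide as the base
    does.\<close>
  have "cross2 P Y D = s * cross2 P Y Z" "cross2 P D Z = (1 - s) * cross2 P Y Z"
    by (simp_all add: s cross2_def algebra_simps)
  then have PYD: "cross2 P Y D = a * c / ((b + c) * p) * \<Delta>"
    and PDZ: "cross2 P D Z = a * b / ((b + c) * p) * \<Delta>"
    by (simp_all add: PYZ bs[symmetric, unfolded s_eq] s_eq)
  have absD: "\<bar>k * \<Delta>\<bar> = k * \<bar>\<Delta>\<bar>" if "k > 0" for k using that by (simp add: abs_mult)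
  have "1 / inradius P Y D =
      (a * c / (b + c) + a / (b + c) * dist P X + dist P Y) / (a * c / ((b + c) * p) * \<bar>\<Delta>\<bar>)"
    using pos p \<Delta> by (subst one_div_inradius) (simp_all add: PYD absD YD PD)
  also have "\<dots> = p / \<bar>\<Delta>\<bar> * (1 + dist P Y * (b + c) / (a * c) + dist P X / c)"
    using pos p \<Delta> by (simp add: divide_simps)
  finally show "1 / inradius P Y D =
      (a + b + c) / \<bar>cross2 X Y Z\<bar> * (1 + dist P Y * (b + c) / (a * c) + dist P X / c)"
    unfolding p_def \<Delta>_def .
  have "1 / inradius P D Z =
      (a * b / (b + c) + dist P Z + a / (b + c) * dist P X) / (a * b / ((b + c) * p) * \<bar>\<Delta>\<bar>)"
    using pos p \<Delta> by (subst one_div_inradius) (simp_all add: PDZ absD DZ PD dist_commute[of Z] dist_commute[of P D])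
  also have "\<dots> = p / \<bar>\<Delta>\<bar> * (1 + dist P Z * (b + c) / (a * b) + dist P X / b)"
    using pos p \<Delta> by (simp add: divide_simps)
  finally show "1 / inradius P D Z =
      (a + b + c) / \<bar>cross2 X Y Z\<bar> * (1 + dist P Z * (b + c) / (a * b) + dist P X / b)"
    unfolding p_def \<Delta>_def .
  show "(dist P X)\<^sup>2 * (a + b + c) = b * c * (b + c - a)"
  proof -
    \<comment> \<open>Expand the squared norm of \<open>p *\<^sub>R (P - X)\<close>, taking the
      inner product from the law of cosines; the factor \<open>p\<close> splits off because (b +
      c)^2 - a^2 = p (b + c - a).\<close>
    define i where "i = (Y - X) \<bullet> (Z - X)"
    have i: "2 * i = b\<^sup>2 + c\<^sup>2 - a\<^sup>2"
      unfolding i_def a_def b_def c_def dist_power2_2D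
      by (simp add: inner_vec_def sum_2 power2_eq_square algebra_simps)
    have bb: "(Z - X) \<bullet> (Z - X) = b\<^sup>2" and cc: "(Y - X) \<bullet> (Y - X) = c\<^sup>2"
      by (simp_all add: b_def c_def dist_norm power2_norm_eq_inner norm_minus_commute[of X])
    have "p *\<^sub>R (P - X) = b *\<^sub>R (Y - X) + c *\<^sub>R (Z - X)"
      unfolding PX using p by (simp add: scaleR_add_right)
    then have "(p *\<^sub>R (P - X)) \<bullet> (p *\<^sub>R (P - X))
        = (b *\<^sub>R (Y - X) + c *\<^sub>R (Z - X)) \<bullet> (b *\<^sub>R (Y - X) + c *\<^sub>R (Z - X))" by simp
    also have "\<dots> = b\<^sup>2 * c\<^sup>2 + c\<^sup>2 * b\<^sup>2 + b * c * (2 * i)"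
      unfolding inner_add_left inner_add_right inner_scaleR_left inner_scaleR_right bb cc
        inner_commute[of "Z - X" "Y - X"] i_def[symmetric]
      by (simp add: power2_eq_square algebra_simps)
    also have "\<dots> = p * (b * c * (b + c - a))"
      unfolding i p_def by (simp add: power2_eq_square algebra_simps)
    finally have "p * ((dist P X)\<^sup>2 * p) = p * (b * c * (b + c - a))"
      by (simp add: dist_norm power2_norm_eq_inner algebra_simps)
    then show ?thesis using p by (simp add: p_def)
  qed
qed

section \<open>The angle condition and the final computation\<close>

lemma angle_at_60:
  assumes "angle_at A B C = pi / 3" "A \<noteq> B" "C \<noteq> B"
  shows "(dist C A)\<^sup>2 = (dist B C)\<^sup>2 + (dist A B)\<^sup>2 - dist B C * dist A B"
proof -
  define q where "q = (A - B) \<bullet> (C - B) / (norm (A - B) * norm (C - B))"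
  \<comment> \<open>Cauchy-Schwarz puts \<open>q\<close> in the range where \<open>cos\<close>
    inverts \<open>arccos\<close>.\<close>
  have "\<bar>q\<bar> \<le> 1"
    using Cauchy_Schwarz_ineq2[of "A - B" "C - B"] assms by (simp add: q_def abs_mult)
  moreover have "arccos q = pi / 3" using assms by (simp add: angle_at_def q_def)
  ultimately have "q = 1 / 2" by (metis cos_60 cos_arccos_abs)
  then have "2 * ((A - B) \<bullet> (C - B)) = norm (A - B) * norm (C - B)"
    using assms by (simp add: q_def field_simps)
  then have "2 * ((A - B) \<bullet> (C - B)) = dist A B * dist B C" by (simp add: dist_norm norm_minus_commute)
  then show ?thesis
    unfolding dist_power2_2D
    by (simp add: inner_vec_def sum_2 power2_eq_square algebra_simps)
qed

theorem theorem6p1: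
  fixes A B C P D E F :: "real ^ 2"
  assumes "\<not> collinear {A, B, C}"
    and "angle_at A B C = pi / 3"
    and "is_incenter A B C P"
    and "D \<in> line A P" and "D \<in> closed_segment B C"
    and "E \<in> line B P" and "E \<in> closed_segment C A"
    and "F \<in> line C P" and "F \<in> closed_segment A B"
  shows "1 / inradius P B D + 1 / inradius P E A + 1 / inradius P A F =
         1 / inradius P D C + 1 / inradius P C E + 1 / inradius P F B"
proof -
  define a b c where "a = dist B C" and "b = dist C A" and "c = dist A B"
  define x y z where "x = dist P A" and "y = dist P B" and "z = dist P C"
  define k where "k = (a + b + c) / \<bar>cross2 A B C\<bar>"
  have neq: "A \<noteq> B" "B \<noteq> C" "C \<noteq> A" using assms(1) by (auto simp: collinear_iff_cross2 cross2_def)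
  then have pos: "a > 0" "b > 0" "c > 0" by (auto simp: a_def b_def c_def)
  have [simp]: "cross2 B C A = cross2 A B C" "cross2 C A B = cross2 A B C"
    by (simp_all add: cross2_def algebra_simps)
  have nc: "\<not> collinear {B, C, A}" "\<not> collinear {C, A, B}"
    using assms(1) by (simp_all add: insert_commute)
  have ic: "is_incenter B C A P" "is_incenter C A B P"
    using assms(3) by (auto simp: is_incenter_def is_incircle_def insert_commute)
  note folds = a_def[symmetric] b_def[symmetric] c_def[symmetric]
    x_def[symmetric] y_def[symmetric] z_def[symmetric]
  \<comment> \<open>The three rotations of the labels supply the pairs PBD, PDC, then PCE, PEA, then
    PAF, PFB.\<close>
  note cA = incenter_cevian[OF assms(1,3,4,5), unfolded folds]
  note cB = incenter_cevian[OF nc(1) ic(1) assms(6,7), unfolded folds]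
  note cC = incenter_cevian[OF nc(2) ic(2) assms(8,9), unfolded folds]
  have k: "(b + c + a) / \<bar>cross2 A B C\<bar> = k" "(c + a + b) / \<bar>cross2 A B C\<bar> = k"
    by (simp_all add: k_def add_ac)
  have b2: "b\<^sup>2 = a\<^sup>2 + c\<^sup>2 - a * c"
    using angle_at_60[OF assms(2)] neq by (auto simp: a_def b_def c_def)
  have key: "a * (a + b) * x = c * (b + c) * z"
  proof -
    have "(a * (a + b) * x)\<^sup>2 * (a + b + c) = (a * (a + b))\<^sup>2 * (b * c * (b + c - a))"
      unfolding cA(3)[symmetric] by (simp add: power2_eq_square)
    also have "\<dots> = (c * (b + c))\<^sup>2 * (a * b * (a + b - c))"
    proof -
      \<comment> \<open>The difference of the two sides factors as (a - c) (a + b + c) (b^2 - a^2 -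
        c^2 + a c), whose last factor vanishes by \<open>b2\<close>.\<close>
      have "a * (a + b)\<^sup>2 * (b + c - a) = c * (b + c)\<^sup>2 * (a + b - c)"
        using b2 by algebra
      then have "(a * b * c) * (a * (a + b)\<^sup>2 * (b + c - a)) = (a * b * c) * (c * (b + c)\<^sup>2 * (a + b - c))"
        by simp
      then show ?thesis by (simp add: power2_eq_square algebra_simps)
    qed
    also have "\<dots> = (c * (b + c) * z)\<^sup>2 * (a + b + c)"
    proof -
      have "a * b * (a + b - c) = z\<^sup>2 * (a + b + c)" using cC(3) by (simp add: add_ac)
      then show ?thesis by (simp add: power_mult_distrib)
    qed
    finally have "(a * (a + b) * x)\<^sup>2 = (c * (b + c) * z)\<^sup>2" using pos by simp
    then show ?thesis
      using pos by (subst (asm) power2_eq_iff_nonneg) (auto simp: x_def z_def)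
  qed
  \<comment> \<open>The constants and all terms in \<open>y\<close> cancel; \<open>x\<close> keeps
    the coefficient 2 (a + b) / (b c) and \<open>z\<close> keeps -2 (b + c) / (a b).\<close>
  have "(1 + y * (b + c) / (a * c) + x / c) + (1 + x * (c + a) / (b * c) + y / c)
      + (1 + x * (a + b) / (c * b) + z / b)
      - ((1 + z * (b + c) / (a * b) + x / b) + (1 + z * (c + a) / (b * a) + y / a)
      + (1 + y * (a + b) / (c * a) + z / a))
      = 2 * (a * (a + b) * x - c * (b + c) * z) / (a * b * c)"
    using pos by (simp add: field_simps)
  also have "\<dots> = 0" by (simp add: key)
  finally have "k * ((1 + y * (b + c) / (a * c) + x / c) + (1 + x * (c + a) / (b * c) + y / c)
      + (1 + x * (a + b) / (c * b) + z / b))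
      = k * ((1 + z * (b + c) / (a * b) + x / b) + (1 + z * (c + a) / (b * a) + y / a)
      + (1 + y * (a + b) / (c * a) + z / a))" by simp
  then show ?thesis
    unfolding cA cB cC k \<open>cross2 B C A = _\<close> \<open>cross2 C A B = _\<close> k_def[symmetric] distrib_left
    by simp
qed

end
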